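(* Let $A\in\mathbb{K}^{m\times n}$, $X\in\mathbb{K}^{n\times p}$, $Y\in\mathbb{K}^{m\times q}$, and assume that $\operatorname{rank}(Y^*AX)=\operatorname{rank}A$. Then \[A=(AX)(Y^*AX)^+(Y^*A).\] Moreover, \[A^+=(Y^*A)^+(Y^*AX)(AX)^+.\]
   Context: $\mathbb{K}=\mathbb{R}$ or $\mathbb{K}=\mathbb{C}$; $M^*$ is the conjugate transpose and $M^+$ the Moore--Penrose pseudoinverse of a matrix $M$. *)

theory Defs
  imports
    "Jordan_Normal_Form.Schur_Decomposition"
    "Jordan_Normal_Form.DL_Rank"
begin

text \<open>
  The conjugate transpose is \<^const>\<open>mat_adjoint\<close>; over the reals \<^const>\<open>conjugate\<close> is the
  identity, so there it is the transpose. The rank of a matrix with \<open>n\<close> rows is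
  \<open>vec_space.rank n\<close>, the dimension of the span of its columns.
\<close>

definition is_pseudoinverse :: "'a :: conjugatable_field mat \<Rightarrow> 'a mat \<Rightarrow> bool" where
  "is_pseudoinverse M G \<longleftrightarrow>
     G \<in> carrier_mat (dim_col M) (dim_row M) \<and>
     M * G * M = M \<and>
     G * M * G = G \<and>
     mat_adjoint (M * G) = M * G \<and>
     mat_adjoint (G * M) = G * M"

text \<open>
  Over \<open>real\<close> and \<open>complex\<close> the four Penrose equations have exactly one solution, so the
  description below is proper. The sort \<open>conjugatable_field\<close> alone does not guarantee existence.
\<close>

definition pseudoinverse :: "'a :: conjugatable_field mat \<Rightarrow> 'a mat" where
  "pseudoinverse M = (THE G. is_pseudoinverse M G)"

end

theory Submission
  imports Defs
begin

text \<open>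
  Put \<open>B = Y\<^sup>*\<close> and \<open>W = B A X\<close>. Multiplication cannot raise the rank, so the hypothesis says that
  passing from \<open>A\<close> to \<open>W\<close> loses nothing on either side: \<open>A\<close> and \<open>A X\<close> have the same column space,
  \<open>A\<close> and \<open>B A\<close> the same row space. In matrix form, \<open>A = A X T\<close> and \<open>A = S B A\<close> for some \<open>S\<close> and \<open>T\<close>
  (\<open>rank_preserving_product_recovers\<close>). Hence \<open>S W = A X\<close> and \<open>W T = B A\<close>, and

  \<open>(A X) W\<^sup>+ (B A) = S W W\<^sup>+ W T = S W T = A\<close>.

  For the second formula let \<open>G = (B A)\<^sup>+ (B A X) (A X)\<^sup>+\<close>. From \<open>A = S B A\<close> follows
  \<open>A (B A)\<^sup>+ (B A) = A\<close>, so \<open>A G = (A X) (A X)\<^sup>+\<close>; from \<open>A = A X T\<close> follows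
  \<open>(A X) (A X)\<^sup>+ A = A\<close>, so \<open>G A = (B A)\<^sup>+ (B A)\<close>. Both products are Hermitian, the other two Penrose
  equations drop out of the same identities, and \<open>G = A\<^sup>+\<close> by uniqueness.

  To produce \<open>S\<close> and \<open>T\<close>, write \<open>A = P C\<close> with inner dimension \<open>r = rank A\<close>. Then
  \<open>W = (B P) (C X)\<close> also has rank \<open>r\<close>, so neither factor can be split through a smaller dimension.
  Hence \<open>B P\<close> has a left inverse \<open>L\<close> and \<open>C X\<close> a right inverse \<open>R\<close>, and \<open>S = P L\<close>, \<open>T = R C\<close> work.
  Formulating minimality through factorizations makes it symmetric under transposition, so only
  column spaces have to be studied.

  That the pseudoinverse exists is shown over any field with a positive definite conjugation,
  which covers the real and the complex numbers at once: the same rank factorization gives inner inverses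
  (\<open>A H A = A\<close>), and an inner inverse of \<open>A\<^sup>* A\<close> gives one of \<open>A\<close> for which \<open>A K\<close> is Hermitian.
\<close>

section \<open>Rank factorizations\<close>

text \<open>
  Associativity with equations between dimensions as side conditions instead of carriers. As a
  rewrite rule it brings every product to right-nested form, so identities that hold by
  associativity alone are proved by the simplifier.
\<close>

lemma mult_assoc_dims:
  fixes A B C :: "'a::semiring_0 mat"
  shows "dim_col A = dim_row B \<Longrightarrow> dim_col B = dim_row C \<Longrightarrow> A * B * C = A * (B * C)"
  by (rule assoc_mult_mat[of A "dim_row A" "dim_row B" B "dim_row C" C "dim_col C"]) auto

lemma factor_through_columns:
  fixes A P :: "'a::field mat"
  assumes A: "A \<in> carrier_mat m n" and P: "P \<in> carrier_mat m k"
    and cols: "\<And>j. j < n \<Longrightarrow> col A j \<in> vec_space.col_space m P"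
  shows "\<exists>C \<in> carrier_mat k n. A = P * C"
proof -
  have "\<exists>x. x \<in> carrier_vec k \<and> P *\<^sub>v x = col A j" if "j < n" for j
    using cols[OF that] vec_space.col_space_eq[OF P] P by auto
  then obtain x where x: "\<And>j. j < n \<Longrightarrow> x j \<in> carrier_vec k \<and> P *\<^sub>v x j = col A j"
    by metis
  define C where "C = mat_of_cols k (map x [0..<n])"
  have C: "C \<in> carrier_mat k n"
    by (simp add: C_def mat_of_cols_def)
  have "A = P * C"
  proof (rule mat_col_eqI)
    fix j assume "j < dim_col (P * C)"
    then have j: "j < n" using C by simp
    have "col C j = x j"
      unfolding C_def using j x[OF j] by (subst col_mat_of_cols) auto
    then show "col A j = col (P * C) j"
      using col_mult2[OF P C j] x[OF j] by simp
  qed (use A P C in auto)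
  with C show ?thesis by blast
qed

text \<open>
  The columns of the left factor are a maximal independent set of columns of \<open>A\<close>; all columns
  of \<open>A\<close> are linear combinations of them.
\<close>

lemma rank_factorization:
  fixes A :: "'a::field mat"
  assumes A: "A \<in> carrier_mat m n"
  defines "r \<equiv> vec_space.rank m A"
  shows "\<exists>P \<in> carrier_mat m r. \<exists>C \<in> carrier_mat r n. A = P * C"
proof -
  interpret vec_space "TYPE('a)" m .
  have carr: "set (cols A) \<subseteq> carrier_vec m" using cols_dim[of A] A by auto
  obtain S where S: "finite S" "maximal S (\<lambda>T. T \<subseteq> set (cols A) \<and> lin_indpt T)"
    using maximal_exists_superset[of "set (cols A)" "\<lambda>T. T \<subseteq> set (cols A) \<and> lin_indpt T" "{}"]
    by (auto simp: lin_dep_def)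
  have SA: "S \<subseteq> set (cols A)" and indep: "lin_indpt S"
    and max: "\<And>T. S \<subseteq> T \<Longrightarrow> T \<subseteq> set (cols A) \<Longrightarrow> lin_indpt T \<Longrightarrow> T = S"
    using S(2) unfolding maximal_def by blast+
  have cardS: "card S = r" unfolding r_def using rank_card_indpt[OF A S(2)] by simp
  obtain xs where xs: "set xs = S" "distinct xs" using finite_distinct_list[OF S(1)] by blast
  define P where "P = mat_of_cols m xs"
  have P: "P \<in> carrier_mat m r"
    using xs cardS distinct_card[of xs] by (simp add: P_def mat_of_cols_def)
  have colsP: "cols P = xs" unfolding P_def using xs SA carr by (intro cols_mat_of_cols) auto
  have "col A j \<in> span S" if j: "j < n" for j
  proof (rule ccontr)
    assume notin: "col A j \<notin> span S"
    have cj: "col A j \<in> set (cols A)" using j A unfolding cols_def by auto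
    then have cj': "col A j \<in> carrier_vec m" using carr by blast
    have Sc: "S \<subseteq> carrier_vec m" using SA carr by blast
    have out: "col A j \<notin> S" using notin span_mem[of S] Sc by auto
    have "lin_indpt (insert (col A j) S)"
      using lin_dep_iff_in_span[of S "col A j"] Sc indep cj' out notin by auto
    then have "insert (col A j) S = S" using max[of "insert (col A j) S"] SA cj by blast
    then show False using out by blast
  qed
  then have "\<exists>C \<in> carrier_mat r n. A = P * C"
    using factor_through_columns[OF A P] unfolding col_space_def colsP xs by blast
  with P show ?thesis by blast
qed

lemma rank_mult_le_inner_dim:
  fixes P Q :: "'a::field mat"
  assumes P: "P \<in> carrier_mat m k" and Q: "Q \<in> carrier_mat k n"
  shows "vec_space.rank m (P * Q) \<le> k"
proof -
  interpret vec_space "TYPE('a)" m .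
  have cP: "set (cols P) \<subseteq> carrier_vec m" and cPQ: "set (cols (P * Q)) \<subseteq> carrier_vec m"
    using cols_dim[of P] cols_dim[of "P * Q"] P by auto
  have "set (cols (P * Q)) \<subseteq> col_space P"
  proof
    fix v assume "v \<in> set (cols (P * Q))"
    then obtain j where j: "j < n" and v: "v = col (P * Q) j" using Q unfolding cols_def by auto
    then have "v = P *\<^sub>v col Q j" using col_mult2[OF P Q j] by simp
    then show "v \<in> col_space P" using col_space_eq[OF P] P Q j by auto
  qed
  then have sub: "span (set (cols (P * Q))) \<subseteq> span (set (cols P))"
    unfolding col_space_def using span_is_subset[of "set (cols (P * Q))" "span (set (cols P))"]
      span_is_submodule[of "set (cols P)"] cP by auto
  have sP: "VectorSpace.subspace class_ring (span (set (cols P))) V"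
    and sPQ: "VectorSpace.subspace class_ring (span (set (cols (P * Q)))) V"
    using span_is_subspace cP cPQ by auto
  have "rank (P * Q) \<le> rank P"
    unfolding rank_def
    using vectorspace.subspace_dim[OF subspace_is_vs[OF sP] nested_subspaces[OF sP sPQ sub]]
      fin_dim_span_cols[OF P] fin_dim_span_cols[OF mult_carrier_mat[OF P Q]] by simp
  also have "\<dots> \<le> k" using rank_le_nc[OF P] .
  finally show ?thesis .
qed

text \<open>
  A matrix with \<open>r\<close> rows that does not factor through a dimension below \<open>r\<close> has rank \<open>r\<close>, by
  \<open>rank_factorization\<close>. Then its columns span the whole space, and writing the unit vectors as
  combinations of columns gives the right inverse.
\<close>

lemma right_inverse_if_no_smaller_factorization:
  fixes N :: "'a::field mat"
  assumes N: "N \<in> carrier_mat r p"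
    and least: "\<And>k P Q. P \<in> carrier_mat r k \<Longrightarrow> Q \<in> carrier_mat k p \<Longrightarrow> N = P * Q \<Longrightarrow> r \<le> k"
  shows "\<exists>R \<in> carrier_mat p r. N * R = 1\<^sub>m r"
proof -
  interpret vec_space "TYPE('a)" r .
  have carr: "set (cols N) \<subseteq> carrier_vec r" using cols_dim[of N] N by auto
  obtain S where S: "finite S" "maximal S (\<lambda>T. T \<subseteq> set (cols N) \<and> lin_indpt T)"
    using maximal_exists_superset[of "set (cols N)" "\<lambda>T. T \<subseteq> set (cols N) \<and> lin_indpt T" "{}"]
    by (auto simp: lin_dep_def)
  have SN: "S \<subseteq> set (cols N)" and indep: "lin_indpt S"
    using S(2) unfolding maximal_def by blast+
  have Sc: "S \<subseteq> carrier_vec r" using SN carr by blast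
  have "r \<le> rank N" using rank_factorization[OF N] least by blast
  then have "dim \<le> card S" using rank_card_indpt[OF N S(2)] by (simp add: dim_is_n)
  then have "card S = dim" using li_le_dim(2)[OF fin_dim, of S] Sc indep by simp
  then have "basis S" using dim_li_is_basis[OF fin_dim S(1)] Sc indep by simp
  then have "span S = carrier_vec r" by (simp add: basis_def)
  then have full: "carrier_vec r \<subseteq> col_space N"
    unfolding col_space_def using span_is_monotone[OF SN] by simp
  have "\<exists>R \<in> carrier_mat p r. 1\<^sub>m r = N * R"
    by (rule factor_through_columns[OF one_carrier_mat N]) (use full in auto)
  then show ?thesis by auto
qed

lemma left_inverse_if_no_smaller_factorization:
  fixes M :: "'a::field mat"
  assumes M: "M \<in> carrier_mat q r"
    and least: "\<And>k P Q. P \<in> carrier_mat q k \<Longrightarrow> Q \<in> carrier_mat k r \<Longrightarrow> M = P * Q \<Longrightarrow> r \<le> k"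
  shows "\<exists>L \<in> carrier_mat r q. L * M = 1\<^sub>m r"
proof -
  have "\<exists>R \<in> carrier_mat q r. transpose_mat M * R = 1\<^sub>m r"
  proof (rule right_inverse_if_no_smaller_factorization)
    fix k P Q assume P: "P \<in> carrier_mat r k" and Q: "Q \<in> carrier_mat k q"
      and eq: "transpose_mat M = P * Q"
    have "M = transpose_mat Q * transpose_mat P"
      using transpose_mult[OF P Q] eq by (metis transpose_transpose)
    then show "r \<le> k" using least[of "transpose_mat Q" k "transpose_mat P"] P Q by simp
  qed (use M in auto)
  then obtain R where R: "R \<in> carrier_mat q r" "transpose_mat M * R = 1\<^sub>m r" by blast
  have "transpose_mat (transpose_mat M * R) = transpose_mat R * M"
    using transpose_mult[of "transpose_mat M" r q R r] M R(1) by simp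
  then have "transpose_mat R * M = 1\<^sub>m r" unfolding R(2) by simp
  then show ?thesis using R by (intro bexI[of _ "transpose_mat R"]) auto
qed

text \<open>
  A factorization of \<open>M\<close> or of \<open>N\<close> through dimension \<open>k\<close> is also one of \<open>M N\<close>, whose rank then
  forces \<open>r \<le> k\<close>.
\<close>

lemma rank_factors_one_sided_inverses:
  fixes M N :: "'a::field mat"
  assumes M: "M \<in> carrier_mat q r" and N: "N \<in> carrier_mat r p"
    and rank: "vec_space.rank q (M * N) = r"
  shows "\<exists>L \<in> carrier_mat r q. L * M = 1\<^sub>m r"
    and "\<exists>R \<in> carrier_mat p r. N * R = 1\<^sub>m r"
proof -
  show "\<exists>L \<in> carrier_mat r q. L * M = 1\<^sub>m r"
  proof (rule left_inverse_if_no_smaller_factorization[OF M])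
    fix k P Q assume P: "P \<in> carrier_mat q k" and Q: "Q \<in> carrier_mat k r" and eq: "M = P * Q"
    have "M * N = P * (Q * N)" using eq P Q N by simp
    then show "r \<le> k" using rank_mult_le_inner_dim[OF P, of "Q * N" p] Q N rank by simp
  qed
  show "\<exists>R \<in> carrier_mat p r. N * R = 1\<^sub>m r"
  proof (rule right_inverse_if_no_smaller_factorization[OF N])
    fix k P Q assume P: "P \<in> carrier_mat r k" and Q: "Q \<in> carrier_mat k p" and eq: "N = P * Q"
    have "M * N = (M * P) * Q" using eq P Q M by simp
    then show "r \<le> k" using rank_mult_le_inner_dim[of "M * P" q k Q p] M P Q rank by simp
  qed
qed

lemma rank_preserving_product_recovers:
  fixes A B X :: "'a::field mat"
  assumes A: "A \<in> carrier_mat m n" and B: "B \<in> carrier_mat q m" and X: "X \<in> carrier_mat n p"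
    and rank: "vec_space.rank q (B * A * X) = vec_space.rank m A"
  shows "\<exists>S \<in> carrier_mat m q. A = S * (B * A)"
    and "\<exists>T \<in> carrier_mat p n. A = A * X * T"
proof -
  define r where "r = vec_space.rank m A"
  obtain P C where P: "P \<in> carrier_mat m r" and C: "C \<in> carrier_mat r n" and APC: "A = P * C"
    using rank_factorization[OF A] unfolding r_def by blast
  have BP: "B * P \<in> carrier_mat q r" and CX: "C * X \<in> carrier_mat r p" using B P C X by auto
  note dims = carrier_matD[OF B] carrier_matD[OF P] carrier_matD[OF C] carrier_matD[OF X]
  have "B * A * X = (B * P) * (C * X)" unfolding APC by (simp add: mult_assoc_dims dims)
  then have rk: "vec_space.rank q ((B * P) * (C * X)) = r" using rank r_def by simp
  obtain L where L: "L \<in> carrier_mat r q" "L * (B * P) = 1\<^sub>m r"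
    using rank_factors_one_sided_inverses(1)[OF BP CX rk] by blast
  obtain R where R: "R \<in> carrier_mat p r" "C * X * R = 1\<^sub>m r"
    using rank_factors_one_sided_inverses(2)[OF BP CX rk] by blast
  have "(P * L) * (B * A) = P * (L * (B * P)) * C"
    unfolding APC by (simp add: mult_assoc_dims dims carrier_matD[OF L(1)])
  then have "A = (P * L) * (B * A)" using L P APC by simp
  then show "\<exists>S \<in> carrier_mat m q. A = S * (B * A)" using P L by (intro bexI[of _ "P * L"]) auto
  have "A * X * (R * C) = P * (C * X * R) * C"
    unfolding APC by (simp add: mult_assoc_dims dims carrier_matD[OF R(1)])
  then have "A = A * X * (R * C)" using R P APC by simp
  then show "\<exists>T \<in> carrier_mat p n. A = A * X * T" using C R by (intro bexI[of _ "R * C"]) auto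
qed

text \<open>If \<open>A = P C\<close> with \<open>L P = 1\<close> and \<open>C R = 1\<close>, then \<open>A (R L) A = P (C R) (L P) C = A\<close>.\<close>

lemma inner_inverse_exists:
  fixes A :: "'a::field mat"
  assumes A: "A \<in> carrier_mat m n"
  shows "\<exists>H \<in> carrier_mat n m. A * H * A = A"
proof -
  define r where "r = vec_space.rank m A"
  obtain P C where P: "P \<in> carrier_mat m r" and C: "C \<in> carrier_mat r n" and APC: "A = P * C"
    using rank_factorization[OF A] unfolding r_def by blast
  have rk: "vec_space.rank m (P * C) = r" by (simp add: r_def APC)
  obtain L where L: "L \<in> carrier_mat r m" "L * P = 1\<^sub>m r"
    using rank_factors_one_sided_inverses(1)[OF P C rk] by blast
  obtain R where R: "R \<in> carrier_mat n r" "C * R = 1\<^sub>m r"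
    using rank_factors_one_sided_inverses(2)[OF P C rk] by blast
  have "A * (R * L) * A = P * (C * R) * (L * P) * C"
    unfolding APC by (simp add: mult_assoc_dims carrier_matD[OF P] carrier_matD[OF C]
        carrier_matD[OF L(1)] carrier_matD[OF R(1)])
  then have "A * (R * L) * A = A" using L(2) R(2) P C APC by simp
  then show ?thesis using L R by (intro bexI[of _ "R * L"]) auto
qed

section \<open>Conjugate transposes\<close>

lemma mat_adjoint_dims [simp]:
  "dim_row (mat_adjoint A) = dim_col A" "dim_col (mat_adjoint A) = dim_row A"
  by (simp_all add: mat_adjoint_def)

lemma mat_adjoint_carrier: "A \<in> carrier_mat m n \<Longrightarrow> mat_adjoint A \<in> carrier_mat n m"
  by (intro carrier_matI) auto

lemma mat_adjoint_index:
  "i < dim_col A \<Longrightarrow> j < dim_row A \<Longrightarrow> mat_adjoint A $$ (i, j) = conjugate (A $$ (j, i))"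
  by (simp add: mat_adjoint_def mat_of_rows_index)

lemma mat_adjoint_adjoint [simp]: "mat_adjoint (mat_adjoint A) = A"
  by (rule eq_matI) (auto simp: mat_adjoint_index)

lemma mat_adjoint_mult:
  assumes "dim_col A = dim_row B"
  shows "mat_adjoint (A * B) = mat_adjoint B * mat_adjoint A"
  by (rule eq_matI)
    (use assms in \<open>auto simp: mat_adjoint_index scalar_prod_def sum_conjugate conjugate_dist_mul mult.commute
       intro!: sum.cong\<close>)

text \<open>
  The diagonal entries of \<open>Z\<^sup>* Z\<close> are the squared norms of the columns of \<open>Z\<close>. This is the only
  place where positivity of the conjugation enters.
\<close>

lemma adjoint_mult_self_eq_0:
  fixes Z :: "'a::conjugatable_ordered_field mat"
  assumes Z: "Z \<in> carrier_mat m k" and zero: "mat_adjoint Z * Z = 0\<^sub>m k k"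
  shows "Z = 0\<^sub>m m k"
proof (rule mat_col_eqI)
  fix j assume "j < dim_col (0\<^sub>m m k :: 'a mat)"
  then have j: "j < k" by simp
  then have c: "col Z j \<in> carrier_vec m" using Z by auto
  have "row (mat_adjoint Z) j = conjugate (col Z j)"
    by (rule eq_vecI) (use j Z in \<open>auto simp: mat_adjoint_index\<close>)
  then have "conjugate (col Z j) \<bullet> col Z j = (mat_adjoint Z * Z) $$ (j, j)" using j Z by simp
  then have "conjugate (col Z j) \<bullet> col Z j = 0" using zero j by simp
  then have "col Z j \<bullet>c col Z j = 0" using conjugate_vec_sprod_comm[OF c c] by simp
  then show "col Z j = col (0\<^sub>m m k) j" using c j by simp
qed (use Z in auto)

text \<open>With \<open>Z = A (D - E)\<close>, \<open>Z\<^sup>* Z = (D - E)\<^sup>* A\<^sup>* A (D - E)\<close> vanishes, so \<open>Z\<close> does.\<close>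

lemma adjoint_mult_left_cancel:
  fixes A :: "'a::conjugatable_ordered_field mat"
  assumes A: "A \<in> carrier_mat m n" and D: "D \<in> carrier_mat n k" and E: "E \<in> carrier_mat n k"
    and eq: "mat_adjoint A * A * D = mat_adjoint A * A * E"
  shows "A * D = A * E"
proof -
  let ?Z = "A * (D - E)"
  note dims = carrier_matD[OF A] carrier_matD[OF D] carrier_matD[OF E]
  have A': "mat_adjoint A \<in> carrier_mat n m" using A by (rule mat_adjoint_carrier)
  have AA: "mat_adjoint A * A \<in> carrier_mat n n" using A A' by simp
  have "mat_adjoint ?Z * ?Z = mat_adjoint (D - E) * (mat_adjoint A * A * (D - E))"
    by (simp add: mat_adjoint_mult mult_assoc_dims dims)
  also have "mat_adjoint A * A * (D - E) = mat_adjoint A * A * D - mat_adjoint A * A * E"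
    using AA D E by (rule mult_minus_distrib_mat)
  also have "\<dots> = 0\<^sub>m n k" unfolding eq using AA E by (intro minus_r_inv_mat) auto
  also have "mat_adjoint (D - E) * 0\<^sub>m n k = 0\<^sub>m k k"
    by (simp add: dims)
  finally have zero: "mat_adjoint ?Z * ?Z = 0\<^sub>m k k" .
  have "?Z \<in> carrier_mat m k" by (intro carrier_matI) (simp_all add: dims)
  from adjoint_mult_self_eq_0[OF this zero] have "A * D - A * E = 0\<^sub>m m k"
    using mult_minus_distrib_mat[OF A D E] by simp
  then have "(A * D - A * E) $$ (i, j) = 0" if "i < m" "j < k" for i j using that by simp
  then have "(A * D) $$ (i, j) = (A * E) $$ (i, j)" if "i < m" "j < k" for i j
    using that A D E by simp
  then show ?thesis by (intro eq_matI) (use A D E in auto)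
qed

section \<open>The Moore--Penrose pseudoinverse\<close>

text \<open>
  \<open>A K\<close> is the orthogonal projector onto the column space of \<open>A\<close>. Take \<open>K = H A\<^sup>*\<close> with an inner
  inverse \<open>H\<close> of \<open>A\<^sup>* A\<close>, and \<open>P = A K\<close>. Cancelling \<open>A\<^sup>*\<close> in \<open>A\<^sup>* A H A\<^sup>* A = A\<^sup>* A\<close> gives \<open>P A = A\<close>.
  Taking adjoints, \<open>A\<^sup>* P\<^sup>* = A\<^sup>*\<close>, hence \<open>P P\<^sup>* = P\<close>; the left-hand side is Hermitian.
\<close>

lemma hermitian_projector_exists:
  fixes A :: "'a::conjugatable_ordered_field mat"
  assumes A: "A \<in> carrier_mat m n"
  shows "\<exists>K \<in> carrier_mat n m. A * K * A = A \<and> mat_adjoint (A * K) = A * K"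
proof -
  let ?B = "mat_adjoint A"
  have B: "?B \<in> carrier_mat n m" using A by (rule mat_adjoint_carrier)
  have BA: "?B * A \<in> carrier_mat n n" using A B by simp
  obtain H where H: "H \<in> carrier_mat n n" "(?B * A) * H * (?B * A) = ?B * A"
    using inner_inverse_exists[OF BA] by blast
  note dims = carrier_matD[OF A] carrier_matD[OF H(1)]
  define P where "P = A * (H * ?B)"
  have dimP [simp]: "dim_row P = m" "dim_col P = m" by (simp_all add: P_def dims)
  have "A * (H * (?B * A)) = A * 1\<^sub>m n"
  proof (rule adjoint_mult_left_cancel[OF A])
    show "H * (?B * A) \<in> carrier_mat n n" using H(1) BA by (rule mult_carrier_mat)
    show "?B * A * (H * (?B * A)) = ?B * A * 1\<^sub>m n"
      using H(2) BA by (simp add: mult_assoc_dims dims)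
  qed (rule one_carrier_mat)
  also have "\<dots> = A" using A by (rule right_mult_one_mat)
  finally have absorb: "A * (H * (?B * A)) = A" .
  have "P * A = A * (H * (?B * A))" unfolding P_def by (simp add: mult_assoc_dims dims)
  then have PA: "P * A = A" unfolding absorb .
  have "mat_adjoint (P * A) = ?B * mat_adjoint P" by (rule mat_adjoint_mult) (simp add: dims)
  then have BP: "?B * mat_adjoint P = ?B" unfolding PA by (rule sym)
  have "P * mat_adjoint P = A * (H * (?B * mat_adjoint P))"
    by (subst P_def) (simp add: mult_assoc_dims dims)
  then have PP: "P * mat_adjoint P = P" unfolding BP P_def[symmetric] .
  have "mat_adjoint (P * mat_adjoint P) = P * mat_adjoint P" by (simp add: mat_adjoint_mult)
  then have "mat_adjoint P = P" unfolding PP .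
  moreover have "H * ?B \<in> carrier_mat n m" using H(1) B by (rule mult_carrier_mat)
  ultimately show ?thesis using PA unfolding P_def by blast
qed

text \<open>
  The preceding lemma for \<open>A\<close> and for \<open>A\<^sup>*\<close> gives two inner inverses, \<open>K\<close> with \<open>A K\<close> Hermitian and
  \<open>M\<close> with \<open>M A\<close> Hermitian. Then \<open>G = M A K\<close> satisfies \<open>A G = A K\<close> and \<open>G A = M A\<close>.
\<close>

lemma pseudoinverse_exists:
  fixes A :: "'a::conjugatable_ordered_field mat"
  shows "\<exists>G. is_pseudoinverse A G"
proof -
  define m n where "m = dim_row A" and "n = dim_col A"
  have A: "A \<in> carrier_mat m n" by (simp add: m_def n_def)
  have A': "mat_adjoint A \<in> carrier_mat n m" using A by (rule mat_adjoint_carrier)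
  obtain K where K: "K \<in> carrier_mat n m" "A * K * A = A" "mat_adjoint (A * K) = A * K"
    using hermitian_projector_exists[OF A] by blast
  obtain J where J: "J \<in> carrier_mat m n" "mat_adjoint A * J * mat_adjoint A = mat_adjoint A"
      "mat_adjoint (mat_adjoint A * J) = mat_adjoint A * J"
    using hermitian_projector_exists[OF A'] by blast
  define M where "M = mat_adjoint J"
  note dims = carrier_matD[OF A] carrier_matD[OF K(1)] carrier_matD[OF J(1)]
  have M: "M \<in> carrier_mat n m" unfolding M_def using J(1) by (rule mat_adjoint_carrier)
  have "mat_adjoint (mat_adjoint A * J * mat_adjoint A) = A * M * A"
    by (simp add: M_def mat_adjoint_mult mult_assoc_dims dims)
  then have AMA: "A * M * A = A" using J(2) by simp
  have MA: "mat_adjoint (M * A) = M * A"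
    using J(3) by (simp add: M_def mat_adjoint_mult dims)
  note dims = dims carrier_matD[OF M]
  let ?G = "M * A * K"
  have AG: "A * ?G = A * K"
  proof -
    have "A * ?G = (A * M * A) * K" by (simp add: mult_assoc_dims dims)
    then show ?thesis by (simp add: AMA)
  qed
  have GA: "?G * A = M * A"
  proof -
    have "?G * A = M * (A * K * A)" by (simp add: mult_assoc_dims dims)
    then show ?thesis by (simp add: K(2))
  qed
  have "?G * A * ?G = M * (A * M * A) * K" unfolding GA by (simp add: mult_assoc_dims dims)
  then have "?G * A * ?G = ?G" by (simp add: AMA)
  moreover have "A * ?G * A = A" unfolding AG by (rule K(2))
  moreover have "?G \<in> carrier_mat (dim_col A) (dim_row A)" using M A K by (simp add: dims)
  ultimately have "is_pseudoinverse A ?G"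
    unfolding is_pseudoinverse_def AG GA using K(3) MA by simp
  then show ?thesis by blast
qed

text \<open>
  \<open>A G\<close> and \<open>A H\<close> are Hermitian and each absorbs the other from the left, so taking adjoints shows
  that they are equal. Likewise \<open>G A = H A\<close>, and then \<open>G = G A G = H A G = H A H = H\<close>.
\<close>

lemma pseudoinverse_unique:
  assumes G: "is_pseudoinverse A G" and H: "is_pseudoinverse A H"
  shows "G = H"
proof -
  have Gc: "G \<in> carrier_mat (dim_col A) (dim_row A)" and Hc: "H \<in> carrier_mat (dim_col A) (dim_row A)"
    using G H by (simp_all add: is_pseudoinverse_def)
  note dims = carrier_matD[OF Gc] carrier_matD[OF Hc]
  note G = G[unfolded is_pseudoinverse_def] and H = H[unfolded is_pseudoinverse_def]
  have "A * G = (A * H * A) * G" using H by simp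
  also have "\<dots> = (A * H) * (A * G)" by (simp add: mult_assoc_dims dims)
  also have "\<dots> = mat_adjoint (A * H) * mat_adjoint (A * G)" using G H by simp
  also have "\<dots> = mat_adjoint ((A * G) * (A * H))" by (simp add: mat_adjoint_mult dims)
  also have "(A * G) * (A * H) = (A * G * A) * H" by (simp add: mult_assoc_dims dims)
  also have "\<dots> = A * H" using G by simp
  also have "mat_adjoint (A * H) = A * H" using H by simp
  finally have left: "A * G = A * H" .
  have "G * A = G * (A * H * A)" using H by simp
  also have "\<dots> = (G * A) * (H * A)" by (simp add: mult_assoc_dims dims)
  also have "\<dots> = mat_adjoint (G * A) * mat_adjoint (H * A)" using G H by simp
  also have "\<dots> = mat_adjoint ((H * A) * (G * A))" by (simp add: mat_adjoint_mult dims)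
  also have "(H * A) * (G * A) = H * (A * G * A)" by (simp add: mult_assoc_dims dims)
  also have "\<dots> = H * A" using G by simp
  also have "mat_adjoint (H * A) = H * A" using H by simp
  finally have right: "G * A = H * A" .
  have "G = G * A * G" using G by simp
  also have "\<dots> = H * (A * G)" unfolding right by (simp add: mult_assoc_dims dims)
  also have "\<dots> = H * A * H" unfolding left by (simp add: mult_assoc_dims dims)
  also have "\<dots> = H" using H by simp
  finally show ?thesis .
qed

lemma pseudoinverse_eqI: "is_pseudoinverse A G \<Longrightarrow> pseudoinverse A = G"
  unfolding pseudoinverse_def by (rule the_equality) (auto intro: pseudoinverse_unique)

lemma is_pseudoinverse_pseudoinverse:
  fixes A :: "'a::conjugatable_ordered_field mat"
  shows "is_pseudoinverse A (pseudoinverse A)"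
  using pseudoinverse_exists[of A] pseudoinverse_eqI by metis

lemma pseudoinverse_dims [simp]:
  fixes A :: "'a::conjugatable_ordered_field mat"
  shows "dim_row (pseudoinverse A) = dim_col A" "dim_col (pseudoinverse A) = dim_row A"
  using is_pseudoinverse_pseudoinverse[of A] by (auto simp: is_pseudoinverse_def)

section \<open>Recovery from rank-preserving products\<close>

text \<open>
  In the proof, \<open>C\<close> and \<open>R\<close> are the products \<open>B A\<close> and \<open>A X\<close>, and primes denote pseudoinverses.
\<close>

lemma matrix_and_pseudoinverse_from_products:
  fixes A B X :: "'a::conjugatable_ordered_field mat"
  assumes A: "A \<in> carrier_mat m n" and B: "B \<in> carrier_mat q m" and X: "X \<in> carrier_mat n p"
    and rank: "vec_space.rank q (B * A * X) = vec_space.rank m A"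
  shows "A = (A * X) * pseudoinverse (B * A * X) * (B * A)"
    and "pseudoinverse A = pseudoinverse (B * A) * (B * A * X) * pseudoinverse (A * X)"
proof -
  obtain S where S: "S \<in> carrier_mat m q" "A = S * (B * A)"
    using rank_preserving_product_recovers(1)[OF A B X rank] by blast
  obtain T where T: "T \<in> carrier_mat p n" "A = A * X * T"
    using rank_preserving_product_recovers(2)[OF A B X rank] by blast
  note dims = carrier_matD[OF A] carrier_matD[OF B] carrier_matD[OF X] carrier_matD[OF S(1)]
    carrier_matD[OF T(1)]
  define W C R where "W = B * A * X" and "C = B * A" and "R = A * X"
  define W' C' R' where "W' = pseudoinverse W" and "C' = pseudoinverse C" and "R' = pseudoinverse R"
  have W': "is_pseudoinverse W W'" and C': "is_pseudoinverse C C'" and R': "is_pseudoinverse R R'"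
    by (simp_all add: W'_def C'_def R'_def is_pseudoinverse_pseudoinverse)
  note pW = W'[unfolded is_pseudoinverse_def] and pC = C'[unfolded is_pseudoinverse_def]
    and pR = R'[unfolded is_pseudoinverse_def]
  have dW: "dim_row W = q" "dim_col W = p" "dim_row W' = p" "dim_col W' = q"
    by (simp_all add: W'_def W_def dims)
  have dC: "dim_row C = q" "dim_col C = n" "dim_row C' = n" "dim_col C' = q"
    by (simp_all add: C'_def C_def dims)
  have dR: "dim_row R = m" "dim_col R = p" "dim_row R' = p" "dim_col R' = m"
    by (simp_all add: R'_def R_def dims)
  note dims = dims dW dC dR
  have SC: "S * C = A" unfolding C_def by (rule S(2)[symmetric])
  have RT: "R * T = A" unfolding R_def by (rule T(2)[symmetric])
  have WCX: "W = C * X" and WBR: "W = B * R"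
    by (simp_all add: W_def C_def R_def mult_assoc_dims dims)
  have SW: "S * W = R"
  proof -
    have "S * W = S * C * X" unfolding WCX by (simp add: mult_assoc_dims dims)
    then show ?thesis by (simp add: SC R_def)
  qed
  have WT: "W * T = C"
  proof -
    have "W * T = B * (R * T)" unfolding WBR by (simp add: mult_assoc_dims dims)
    then show ?thesis by (simp add: RT C_def)
  qed
  have "R * W' * C = S * (W * W' * W) * T"
    unfolding SW[symmetric] WT[symmetric] by (simp add: mult_assoc_dims dims)
  also have "\<dots> = R * T" using pW by (simp add: SW)
  finally have "R * W' * C = A" by (simp add: RT)
  then show "A = (A * X) * pseudoinverse (B * A * X) * (B * A)"
    by (simp add: R_def C_def W'_def W_def)
  have AC: "A * (C' * C) = A"
  proof -
    have "A * (C' * C) = S * (C * C' * C)" unfolding SC[symmetric] by (simp add: mult_assoc_dims dims)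
    then show ?thesis using pC SC by simp
  qed
  have RA: "R * R' * A = A"
  proof -
    have "R * R' * A = (R * R' * R) * T" unfolding RT[symmetric] by (simp add: mult_assoc_dims dims)
    then show ?thesis using pR RT by simp
  qed
  let ?G = "C' * W * R'"
  have AG: "A * ?G = R * R'"
  proof -
    have "A * ?G = A * (C' * C) * X * R'" unfolding WCX by (simp add: mult_assoc_dims dims)
    then show ?thesis by (simp add: AC R_def)
  qed
  have GA: "?G * A = C' * C"
  proof -
    have "?G * A = C' * B * (R * R' * A)" unfolding WBR by (simp add: mult_assoc_dims dims)
    also have "\<dots> = C' * C" by (simp add: RA C_def mult_assoc_dims dims)
    finally show ?thesis .
  qed
  have "?G * A * ?G = (C' * C * C') * W * R'" unfolding GA by (simp add: mult_assoc_dims dims)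
  then have "?G * A * ?G = ?G" using pC by simp
  moreover have "?G \<in> carrier_mat (dim_col A) (dim_row A)" by (intro carrier_matI) (simp_all add: dims)
  ultimately have "is_pseudoinverse A ?G"
    unfolding is_pseudoinverse_def AG GA using RA pR pC by simp
  then have "pseudoinverse A = ?G" by (rule pseudoinverse_eqI)
  then show "pseudoinverse A = pseudoinverse (B * A) * (B * A * X) * pseudoinverse (A * X)"
    by (simp add: W_def C_def R_def C'_def R'_def)
qed

theorem lemma6p1:
  shows
    "(\<forall>(m::nat) (n::nat) (p::nat) (q::nat) (A::real mat) (X::real mat) (Y::real mat).
        A \<in> carrier_mat m n \<longrightarrow> X \<in> carrier_mat n p \<longrightarrow> Y \<in> carrier_mat m q \<longrightarrow>
        vec_space.rank q (mat_adjoint Y * A * X) = vec_space.rank m A \<longrightarrow>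
        A = (A * X) * pseudoinverse (mat_adjoint Y * A * X) * (mat_adjoint Y * A) \<and>
        pseudoinverse A =
          pseudoinverse (mat_adjoint Y * A) * (mat_adjoint Y * A * X) * pseudoinverse (A * X)) \<and>
     (\<forall>(m::nat) (n::nat) (p::nat) (q::nat) (A::complex mat) (X::complex mat) (Y::complex mat).
        A \<in> carrier_mat m n \<longrightarrow> X \<in> carrier_mat n p \<longrightarrow> Y \<in> carrier_mat m q \<longrightarrow>
        vec_space.rank q (mat_adjoint Y * A * X) = vec_space.rank m A \<longrightarrow>
        A = (A * X) * pseudoinverse (mat_adjoint Y * A * X) * (mat_adjoint Y * A) \<and>
        pseudoinverse A =
          pseudoinverse (mat_adjoint Y * A) * (mat_adjoint Y * A * X) * pseudoinverse (A * X))"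
proof (intro conjI allI impI)
  fix m n p q :: nat and A X Y :: "real mat"
  assume A: "A \<in> carrier_mat m n" and X: "X \<in> carrier_mat n p" and Y: "Y \<in> carrier_mat m q"
    and rank: "vec_space.rank q (mat_adjoint Y * A * X) = vec_space.rank m A"
  note * = matrix_and_pseudoinverse_from_products[OF A mat_adjoint_carrier[OF Y] X rank]
  show "A = (A * X) * pseudoinverse (mat_adjoint Y * A * X) * (mat_adjoint Y * A)" by (rule *(1))
  show "pseudoinverse A =
      pseudoinverse (mat_adjoint Y * A) * (mat_adjoint Y * A * X) * pseudoinverse (A * X)" by (rule *(2))
next
  fix m n p q :: nat and A X Y :: "complex mat"
  assume A: "A \<in> carrier_mat m n" and X: "X \<in> carrier_mat n p" and Y: "Y \<in> carrier_mat m q"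
    and rank: "vec_space.rank q (mat_adjoint Y * A * X) = vec_space.rank m A"
  note * = matrix_and_pseudoinverse_from_products[OF A mat_adjoint_carrier[OF Y] X rank]
  show "A = (A * X) * pseudoinverse (mat_adjoint Y * A * X) * (mat_adjoint Y * A)" by (rule *(1))
  show "pseudoinverse A =
      pseudoinverse (mat_adjoint Y * A) * (mat_adjoint Y * A * X) * pseudoinverse (A * X)" by (rule *(2))
qed

end
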